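(* Let $n,d\ge1$ be integers, $\mathbb{K}$ a field, and $X=(x_{p,q})_{(d+1)\times n}$ a matrix of indeterminates over $\mathbb{K}$. For distinct integers $\ell_1,\dots,\ell_d,j_1$ in $[n]=\{1,\dots,n\}$ we have $$\det(x_{1,j_1}\ell_1-x_{1,\ell_1}j_1,\ \ell_2,\dots,\ell_d)_{2,\dots,d+1}=\det(j_1,\ell_1,\dots,\ell_d)+\sum_{2\le r\le d}(-1)^{r+1}x_{1,\ell_r}\det(j_1,\ell_1,\dots,\widehat{\ell_r},\dots,\ell_d)_{2,\dots,d+1}.$$
   Context: All determinants live in $S=\mathbb{K}[x_{p,q}\mid 1\le p\le d+1,\ 1\le q\le n]$. An index $\ell\in[n]$ appearing as an entry of a list stands for the $\ell$-th column of $X$; for $f,g\in S$ and $j,j'\in[n]$, the entry $fj-gj'$ stands for the column vector with $p$-th coordinate $f x_{p,j}-g x_{p,j'}$ ($1\le p\le d+1$). For a list of $t$ such columns $c_1,\dots,c_t$ and rows $i_1<\dots<i_t$, $(c_1,\dots,c_t)_{i_1,\dots,i_t}$ is the $t\times t$ matrix with these columns, in this order, restricted to rows $i_1,\dots,i_t$; when $t=d+1$ the row subscript $1,\dots,d+1$ is omitted. A hat means that the entry is omitted from the list. *)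

theory Defs
  imports
    "HOL-Library.Poly_Mapping"
    "Jordan_Normal_Form.Determinant"
    "Jordan_Normal_Form.DL_Submatrix"
begin

text \<open>
  Polynomials over \<open>'a\<close> in indeterminates \<open>indet p q\<close> indexed by all pairs of natural numbers:
  finitely supported maps from monomials (finitely supported exponent functions) to coefficients.
  This ring contains \<open>\<bbbK>[indet p q | 1 \<le> p \<le> d + 1, 1 \<le> q \<le> n]\<close> as a subring for all \<open>d\<close> and \<open>n\<close>,
  and the entries of the matrix \<open>gen_mat d n\<close> below lie in that subring.
\<close>

type_synonym 'a polyn = "((nat \<times> nat) \<Rightarrow>\<^sub>0 nat) \<Rightarrow>\<^sub>0 'a"

definition indet :: "nat \<Rightarrow> nat \<Rightarrow> 'a::field polyn" where
  "indet p q = Poly_Mapping.single (Poly_Mapping.single (p, q) 1) 1"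

text \<open>
  Library vectors and matrices are indexed from 0. The indices \<open>p\<close>, \<open>q\<close> of \<open>indet p q\<close>, the column
  indices \<open>l\<close> in \<open>column\<close> and \<open>comb\<close>, and the row indices in \<open>minor_mat\<close> start at 1.
\<close>

definition gen_mat :: "nat \<Rightarrow> nat \<Rightarrow> 'a::field polyn mat" where
  "gen_mat d n = mat (d + 1) n (\<lambda>(i, j). indet (i + 1) (j + 1))"

definition column :: "nat \<Rightarrow> nat \<Rightarrow> nat \<Rightarrow> 'a::field polyn vec" where
  "column d n l = col (gen_mat d n) (l - 1)"

text \<open>The list entry \<open>f j - g j'\<close>.\<close>

definition comb ::
  "nat \<Rightarrow> nat \<Rightarrow> 'a::field polyn \<Rightarrow> nat \<Rightarrow> 'a polyn \<Rightarrow> nat \<Rightarrow> 'a polyn vec" where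
  "comb d n f j g j' = f \<cdot>\<^sub>v column d n j - g \<cdot>\<^sub>v column d n j'"

text \<open>The matrix \<open>(c\<^sub>1, \<dots>, c\<^sub>t)\<close> restricted to the rows whose (1-based) index lies in \<open>I\<close>.\<close>

definition minor_mat :: "nat \<Rightarrow> 'a::field polyn vec list \<Rightarrow> nat set \<Rightarrow> 'a polyn mat" where
  "minor_mat d cs I = submatrix (mat_of_cols (d + 1) cs) {i. i + 1 \<in> I} UNIV"

end

theory Submission
  imports Defs
begin

text \<open>
  Expanding \<open>det (j\<^sub>1, l\<^sub>1, \<dots>, l\<^sub>d)\<close> along its first row gives \<open>d + 1\<close> terms. The sum in the theorem
  cancels all but those of the columns \<open>j\<^sub>1\<close> and \<open>l\<^sub>1\<close>, which are
  \<open>x\<^bsub>1,j\<^sub>1\<^esub> det (l\<^sub>1, l\<^sub>2, \<dots>, l\<^sub>d) - x\<^bsub>1,l\<^sub>1\<^esub> det (j\<^sub>1, l\<^sub>2, \<dots>, l\<^sub>d)\<close> on the rows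
  \<open>2, \<dots>, d + 1\<close>. By linearity in the first column this is the determinant on the left-hand side.
  The expansion is \<open>det_expand_first_row\<close> and the linearity is \<open>det_minor_mat_linear_hd\<close>.
  Nothing depends on the entries being indeterminates: \<open>det_eliminate_first_row\<close> is the identity
  for arbitrary columns \<open>u, c 1, \<dots>, c d\<close> over the polynomial ring.
\<close>

lemma pick_atLeastAtMost:
  assumes "m + i \<le> k"
  shows "pick {m..k} i = m + i"
  using assms
proof (induction i)
  case 0
  then show ?case
    by (auto intro!: Least_equality)
next
  case (Suc i)
  then have "pick {m..k} (Suc i) = (LEAST a. a \<in> {m..k} \<and> m + i < a)"
    by simp
  also have "\<dots> = m + Suc i"
    by (rule Least_equality) (use Suc.prems in auto)
  finally show ?case .
qed

lemma minor_mat_rows_from: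
  assumes "m \<le> d"
  shows "minor_mat d cs {m + 1..d + 1} =
    mat (d + 1 - m) (length cs) (\<lambda>(i, j). cs ! j $ (m + i))"
proof -
  have rows: "{i. i + 1 \<in> {m + 1..d + 1}} = {m..d}"
    by auto
  have "{i. i < d + 1 \<and> i \<in> {m..d}} = {m..d}"
    by auto
  then have dim: "card {i. i < d + 1 \<and> i \<in> {m..d}} = d + 1 - m"
    by simp
  show ?thesis
    unfolding minor_mat_def rows submatrix_def
  proof (intro eq_matI, goal_cases)
    case (1 i j)
    then have "i < d + 1 - m" and "j < length cs"
      by auto
    then show ?case
      using dim by (simp add: pick_atLeastAtMost pick_UNIV mat_of_cols_index del: pick.simps)
  qed (use dim in simp_all)
qed

lemma minor_mat_all_rows: "minor_mat d cs {1..d + 1} = mat_of_cols (d + 1) cs"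
  using minor_mat_rows_from [of 0 d cs] by (simp add: mat_of_cols_def)

lemma minor_mat_lower_rows:
  assumes "d \<ge> 1"
  shows "minor_mat d cs {2..d + 1} = mat d (length cs) (\<lambda>(i, j). cs ! j $ Suc i)"
  using minor_mat_rows_from [OF assms, of cs] by (simp add: numeral_2_eq_2)

text \<open>
  Rows and columns of the library matrices count from 0, so the first row is row 0 and the sign of
  the term that omits the \<open>k\<close>-th entry of the list is \<open>(- 1) ^ k\<close>.
\<close>

lemma det_expand_first_row:
  assumes d: "d \<ge> 1" and len: "length cs = d + 1"
  shows "det (minor_mat d cs {1..d + 1}) =
    (\<Sum>k\<le>d. (- 1) ^ k * cs ! k $ 0 * det (minor_mat d (take k cs @ drop (Suc k) cs) {2..d + 1}))"
proof -
  let ?A = "mat_of_cols (d + 1) cs"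
  have "?A \<in> carrier_mat (d + 1) (d + 1)"
    using len by auto
  then have "det ?A = (\<Sum>k<d + 1. ?A $$ (0, k) * cofactor ?A 0 k)"
    by (rule laplace_expansion_row) simp
  also have "\<dots> = (\<Sum>k<d + 1. (- 1) ^ k * cs ! k $ 0 *
      det (minor_mat d (take k cs @ drop (Suc k) cs) {2..d + 1}))"
  proof (rule sum.cong)
    fix k assume "k \<in> {..<d + 1}"
    then have k: "k < d + 1" by simp
    have "mat_delete ?A 0 k = minor_mat d (take k cs @ drop (Suc k) cs) {2..d + 1}"
      unfolding minor_mat_lower_rows [OF d] mat_delete_def using len k
      by (intro eq_matI) (auto simp: mat_of_cols_index nth_append min_def)
    then show "?A $$ (0, k) * cofactor ?A 0 k = (- 1) ^ k * cs ! k $ 0 *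
        det (minor_mat d (take k cs @ drop (Suc k) cs) {2..d + 1})"
      using len k by (simp add: cofactor_def mat_of_cols_index mult_ac)
  qed simp
  finally show ?thesis
    unfolding minor_mat_all_rows by (simp add: lessThan_Suc_atMost)
qed

lemma det_minor_mat_linear_hd:
  assumes len: "length cs + 1 = d" and u: "u \<in> carrier_vec (d + 1)" and v: "v \<in> carrier_vec (d + 1)"
  shows "det (minor_mat d ((f \<cdot>\<^sub>v u - g \<cdot>\<^sub>v v) # cs) {2..d + 1}) =
    f * det (minor_mat d (u # cs) {2..d + 1}) - g * det (minor_mat d (v # cs) {2..d + 1})"
proof -
  have d: "d \<ge> 1"
    using len by simp
  let ?M = "\<lambda>w. minor_mat d (w # cs) {2..d + 1}"
  define c where "c i = cofactor (?M u) i 0" for i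
  have expand: "det (?M w) = (\<Sum>i<d. w $ Suc i * c i)" for w
  proof -
    have "?M w \<in> carrier_mat d d"
      unfolding minor_mat_lower_rows [OF d] using len by auto
    then have "det (?M w) = (\<Sum>i<d. ?M w $$ (i, 0) * cofactor (?M w) i 0)"
      by (rule laplace_expansion_column) (use len in simp)
    also have "\<dots> = (\<Sum>i<d. w $ Suc i * c i)"
    proof (rule sum.cong)
      fix i assume i: "i \<in> {..<d}"
      \<comment> \<open>The cofactors along the first column do not involve that column.\<close>
      have "mat_delete (?M w) i 0 = mat_delete (?M u) i 0"
        unfolding minor_mat_lower_rows [OF d] mat_delete_def by (intro eq_matI) auto
      moreover have "?M w $$ (i, 0) = w $ Suc i"
        unfolding minor_mat_lower_rows [OF d] using i by simp
      ultimately show "?M w $$ (i, 0) * cofactor (?M w) i 0 = w $ Suc i * c i"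
        by (simp add: c_def cofactor_def)
    qed simp
    finally show ?thesis .
  qed
  show ?thesis
    unfolding expand sum_distrib_left sum_subtractf [symmetric]
    by (rule sum.cong) (use u v in \<open>auto simp: algebra_simps\<close>)
qed

lemma filter_neq_upt:
  assumes "a \<le> r" and "r < b"
  shows "filter (\<lambda>s. s \<noteq> r) [a..<b] = [a..<r] @ [Suc r..<b]"
proof -
  have "[a..<b] = [a..<r] @ r # [Suc r..<b]"
    using assms by (metis le_add_diff_inverse less_imp_le upt_add_eq_append upt_conv_Cons)
  then show ?thesis
    by (simp add: filter_id_conv)
qed

text \<open>
  The combination \<open>u\<^sub>0 c\<^sub>1 - (c\<^sub>1)\<^sub>0 u\<close> is the one whose entry in the first row vanishes; its
  determinant on the remaining rows collects the terms for \<open>u\<close> and \<open>c\<^sub>1\<close> in the expansion of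
  \<open>det (u, c\<^sub>1, \<dots>, c\<^sub>d)\<close>.
\<close>

lemma det_eliminate_first_row:
  fixes u :: "'a::field polyn vec" and c :: "nat \<Rightarrow> 'a polyn vec"
  assumes d: "d \<ge> 1" and u: "u \<in> carrier_vec (d + 1)" and c: "c 1 \<in> carrier_vec (d + 1)"
  shows "det (minor_mat d ((u $ 0 \<cdot>\<^sub>v c 1 - c 1 $ 0 \<cdot>\<^sub>v u) # map c [2..<d + 1]) {2..d + 1}) =
    det (minor_mat d (u # map c [1..<d + 1]) {1..d + 1}) +
    (\<Sum>r = 2..d. (- 1) ^ (r + 1) * c r $ 0 *
      det (minor_mat d (u # map c (filter (\<lambda>s. s \<noteq> r) [1..<d + 1])) {2..d + 1}))"
proof -
  define cs where "cs = u # map c [1..<d + 1]"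
  define rest where "rest = map c [2..<d + 1]"
  define D where "D xs = det (minor_mat d xs {2..d + 1})" for xs :: "'a polyn vec list"
  define omit where "omit r = D (u # map c (filter (\<lambda>s. s \<noteq> r) [1..<d + 1]))" for r
  \<comment> \<open>The \<open>k\<close>-th term of the expansion: \<open>u\<close> is entry 0 of \<open>cs\<close> and \<open>c k\<close> is entry \<open>k\<close>.\<close>
  define t where "t k = (- 1) ^ k * cs ! k $ 0 * D (take k cs @ drop (Suc k) cs)" for k
  have upt: "[1..<d + 1] = 1 # [2..<d + 1]"
    using d by (simp add: upt_conv_Cons numeral_2_eq_2)
  have len: "length rest + 1 = d"
    using d unfolding rest_def length_map length_upt by linarith
  have t_0: "t 0 = u $ 0 * D (c 1 # rest)"
    unfolding t_def cs_def rest_def upt by simp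
  have t_pos: "t k = (- 1) ^ k * c k $ 0 * omit k" if k: "1 \<le> k" "k \<le> d" for k
  proof -
    have "take k cs @ drop (Suc k) cs = u # map c (filter (\<lambda>s. s \<noteq> k) [1..<d + 1])"
      using k unfolding cs_def
      by (subst filter_neq_upt)
        (simp_all add: take_Cons' take_map drop_map del: upt_Suc)
    moreover have "cs ! k = c k"
      using k unfolding cs_def by (simp add: nth_Cons' del: upt_Suc)
    ultimately show ?thesis
      by (simp only: t_def omit_def)
  qed
  have omit_1: "omit 1 = D (u # rest)"
    using d unfolding omit_def rest_def
    by (subst filter_neq_upt) (simp_all add: numeral_2_eq_2 del: upt_Suc)
  have "det (minor_mat d cs {1..d + 1}) = (\<Sum>k\<le>d. t k)"
    unfolding t_def D_def by (rule det_expand_first_row [OF d]) (simp add: cs_def)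
  also have "{..d} = insert 0 (insert 1 {2..d})"
    using d by auto
  also have "(\<Sum>k\<in>\<dots>. t k) = t 0 + t 1 + (\<Sum>k = 2..d. t k)"
    by (simp add: add.assoc)
  also have "(\<Sum>k = 2..d. t k) = - (\<Sum>k = 2..d. (- 1) ^ (k + 1) * c k $ 0 * omit k)"
    unfolding sum_negf [symmetric] by (rule sum.cong) (simp_all add: t_pos)
  also have "t 0 + t 1 = u $ 0 * D (c 1 # rest) - c 1 $ 0 * D (u # rest)"
    using t_pos [of 1] d by (simp add: t_0 omit_1 [unfolded One_nat_def])
  also have "\<dots> = D ((u $ 0 \<cdot>\<^sub>v c 1 - c 1 $ 0 \<cdot>\<^sub>v u) # rest)"
    unfolding D_def by (rule det_minor_mat_linear_hd [symmetric]) (use u c len in simp_all)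
  finally show ?thesis
    unfolding D_def omit_def cs_def rest_def by (simp only: eq_diff_eq diff_conv_add_uminus [symmetric])
qed

theorem lemma2p4:
  fixes n d j1 :: nat and l :: "nat \<Rightarrow> nat"
  assumes "n \<ge> 1" and "d \<ge> 1"
    and "\<And>r. r \<in> {1..d} \<Longrightarrow> l r \<in> {1..n}" and "j1 \<in> {1..n}"
    and "inj_on l {1..d}" and "j1 \<notin> l ` {1..d}"
  shows
    "det (minor_mat d
        (comb d n (indet 1 j1) (l 1) (indet 1 (l 1)) j1 # map (\<lambda>r. column d n (l r)) [2..<d + 1])
        {2..d + 1}) =
     (det (minor_mat d (column d n j1 # map (\<lambda>r. column d n (l r)) [1..<d + 1]) {1..d + 1})
      + (\<Sum>r = 2..d. (- 1) ^ (r + 1) * indet 1 (l r) *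
          det (minor_mat d
            (column d n j1 # map (\<lambda>s. column d n (l s)) (filter (\<lambda>s. s \<noteq> r) [1..<d + 1]))
            {2..d + 1})) :: 'k::field polyn)"
proof -
  have carrier: "column d n q \<in> carrier_vec (d + 1)" for q
    unfolding column_def gen_mat_def by (rule carrier_vecI) simp
  have top: "column d n q $ 0 = indet 1 q" if "q \<in> {1..n}" for q
    using that by (auto simp: column_def gen_mat_def)
  have top_l: "column d n (l r) $ 0 = indet 1 (l r)" if "r \<in> {1..d}" for r
    using that by (intro top assms(3))
  let ?omit = "\<lambda>r. det (minor_mat d
      (column d n j1 # map (\<lambda>s. column d n (l s)) (filter (\<lambda>s. s \<noteq> r) [1..<d + 1]))
      {2..d + 1}) :: 'k polyn"
  have sum_eq: "(\<Sum>r = 2..d. (- 1) ^ (r + 1) * column d n (l r) $ 0 * ?omit r) =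
      (\<Sum>r = 2..d. (- 1) ^ (r + 1) * indet 1 (l r) * ?omit r)"
  proof (rule sum.cong)
    fix r assume "r \<in> {2..d}"
    then have "r \<in> {1..d}"
      by simp
    then show "(- 1) ^ (r + 1) * column d n (l r) $ 0 * ?omit r =
        (- 1) ^ (r + 1) * indet 1 (l r) * ?omit r"
      by (simp only: top_l)
  qed (rule refl)
  have "1 \<in> {1..d}"
    using assms(2) by simp
  from det_eliminate_first_row
      [where u = "column d n j1 :: 'k polyn vec" and c = "\<lambda>r. column d n (l r)",
        OF assms(2) carrier carrier]
  show ?thesis
    unfolding sum_eq top [OF assms(4)] top_l [OF \<open>1 \<in> {1..d}\<close>] comb_def .
qed

end
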